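(* Let $c_1,\dots,c_K>0$ and define $\mathcal{L}_i'(\theta)=c_i\mathcal{L}_i(\theta)$ for $i=1,\dots,K$. With the normalization $s_{i,t}=(\hat v_{i,t}+\varepsilon)^{-1/2}$, as $\varepsilon\to0$ (or once $\hat v_{i,t}\gg\varepsilon/c_i^2$ for all $i$), the PCD direction computed from $(\mathcal{L}_1',\dots,\mathcal{L}_K')$ coincides with that computed from $(\mathcal{L}_1,\dots,\mathcal{L}_K)$. With the alternative normalization $s_{i,t}=(\hat v_{i,t}(1+\varepsilon))^{-1/2}$, scale invariance is exact for all $\varepsilon\ge0$, i.e. the PCD direction computed from $(\mathcal{L}_1',\dots,\mathcal{L}_K')$ equals that computed from $(\mathcal{L}_1,\dots,\mathcal{L}_K)$ for every $\varepsilon\ge0$.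
   Context: There are $K\ge2$ objectives $\mathcal{L}_1,\dots,\mathcal{L}_K$ on $\mathbb{R}^n$: $\mathcal{L}_1$ (primary) is continuously differentiable, and $\mathcal{L}_2,\dots,\mathcal{L}_K$ (secondary) are proper, convex and lower semi-continuous with values in $\mathbb{R}\cup\{+\infty\}$. At iteration $t\ge1$, $g_{i,t}\in\mathbb{R}^n$ denotes the gradient (for $i=1$) or a subgradient (for $i\ge2$) of $\mathcal{L}_i$ at the current parameter; under $\mathcal{L}_i\to c_i\mathcal{L}_i$ it becomes $c_ig_{i,t}$. Fix $\beta\in(0,1)$, a stabilizer $\varepsilon$ ($\varepsilon>0$ in the standard normalization), and a tolerance $\tau\in[0,1]$. The exponential-moving-average normalization is $v_{i,0}=0$, $v_{i,t}=\beta v_{i,t-1}+(1-\beta)\|g_{i,t}\|^2$, $\hat v_{i,t}=v_{i,t}/(1-\beta^t)$, $s_{i,t}=(\hat v_{i,t}+\varepsilon)^{-1/2}$ (or the alternative formula given in the claim), and $\tilde g_{i,t}=s_{i,t}g_{i,t}$, with $\|\cdot\|$ the Euclidean norm. Whenever the constraint set is nonempty, the PCD (Priority-Constrained Descent) direction is $\tilde d^*=\arg\min\{\|d-\tilde g_{1,t}\|^2:\ d\in\mathbb{R}^n,\ \tilde g_{j,t}^\top d\ge\tau\|\tilde g_{j,t}\|^2\ \text{for all } j\in\{2,\dots,K\}\}$. *)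

theory Defs
  imports "HOL-Analysis.Analysis"
begin

definition continuously_differentiable :: "('a::real_inner \<Rightarrow> real) \<Rightarrow> bool" where
  "continuously_differentiable f \<longleftrightarrow>
     (\<exists>G. continuous_on UNIV G \<and> (\<forall>x. GDERIV f x :> G x))"

definition proper_fun :: "('a \<Rightarrow> ereal) \<Rightarrow> bool" where
  "proper_fun f \<longleftrightarrow> (\<forall>x. f x \<noteq> - \<infinity>) \<and> (\<exists>x. f x \<noteq> \<infinity>)"

(* With values in (-\<infinity>, \<infinity>] the right-hand side is never \<infinity> - \<infinity>; the endpoints u = 0, 1 are
   harmless because 0 * \<infinity> = 0 in ereal. *)
definition convex_fun :: "('a::real_vector \<Rightarrow> ereal) \<Rightarrow> bool" where
  "convex_fun f \<longleftrightarrow>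
     (\<forall>x y. \<forall>u\<in>{0..1::real}.
        f ((1 - u) *\<^sub>R x + u *\<^sub>R y) \<le> ereal (1 - u) * f x + ereal u * f y)"

definition lsc_fun :: "('a::topological_space \<Rightarrow> ereal) \<Rightarrow> bool" where
  "lsc_fun f \<longleftrightarrow> (\<forall>x. f x \<le> Liminf (at x) f)"

definition is_subgradient :: "('a::real_inner \<Rightarrow> ereal) \<Rightarrow> 'a \<Rightarrow> 'a \<Rightarrow> bool" where
  "is_subgradient f x p \<longleftrightarrow>
     \<bar>f x\<bar> \<noteq> \<infinity> \<and> (\<forall>y. f x + ereal (p \<bullet> (y - x)) \<le> f y)"

(* The primary objective is L1; the secondary objectives are L i for 2 \<le> i \<le> K. *)
definition pcd_objectives ::
  "nat \<Rightarrow> ('a::euclidean_space \<Rightarrow> real) \<Rightarrow> (nat \<Rightarrow> 'a \<Rightarrow> ereal) \<Rightarrow> bool" where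
  "pcd_objectives K L1 L \<longleftrightarrow>
     continuously_differentiable L1 \<and>
     (\<forall>i\<in>{2..K}. proper_fun (L i) \<and> convex_fun (L i) \<and> lsc_fun (L i))"

(* \<theta> t is the parameter at iteration t \<ge> 1 and g i t the (sub)gradient of objective i there. *)
definition gradient_history ::
  "nat \<Rightarrow> ('a::euclidean_space \<Rightarrow> real) \<Rightarrow> (nat \<Rightarrow> 'a \<Rightarrow> ereal) \<Rightarrow> (nat \<Rightarrow> 'a)
     \<Rightarrow> (nat \<Rightarrow> nat \<Rightarrow> 'a) \<Rightarrow> bool" where
  "gradient_history K L1 L \<theta> g \<longleftrightarrow>
     (\<forall>t\<ge>1. GDERIV L1 (\<theta> t) :> g 1 t \<and> (\<forall>i\<in>{2..K}. is_subgradient (L i) (\<theta> t) (g i t)))"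

(* In the next three definitions h is the gradient sequence of a single objective. *)
primrec ema :: "real \<Rightarrow> (nat \<Rightarrow> 'a::real_normed_vector) \<Rightarrow> nat \<Rightarrow> real" where
  "ema \<beta> h 0 = 0"
| "ema \<beta> h (Suc t) = \<beta> * ema \<beta> h t + (1 - \<beta>) * (norm (h (Suc t)))\<^sup>2"

definition ema_hat :: "real \<Rightarrow> (nat \<Rightarrow> 'a::real_normed_vector) \<Rightarrow> nat \<Rightarrow> real" where
  "ema_hat \<beta> h t = ema \<beta> h t / (1 - \<beta> ^ t)"

(* S maps the bias-corrected average to the scale factor; the two choices of S follow. *)
definition normalized ::
  "(real \<Rightarrow> real) \<Rightarrow> real \<Rightarrow> (nat \<Rightarrow> 'a::real_normed_vector) \<Rightarrow> nat \<Rightarrow> 'a" where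
  "normalized S \<beta> h t = S (ema_hat \<beta> h t) *\<^sub>R h t"

definition scale_std :: "real \<Rightarrow> real \<Rightarrow> real" where
  "scale_std \<epsilon> v = (v + \<epsilon>) powr (- (1 / 2))"

(* At v = 0 the value 0 powr (-1/2) = 0 is immaterial: for t \<ge> 1 the average vanishes only if all
   gradients up to t do, and then the normalized gradient is 0 for any scale factor. *)
definition scale_alt :: "real \<Rightarrow> real \<Rightarrow> real" where
  "scale_alt \<epsilon> v = (v * (1 + \<epsilon>)) powr (- (1 / 2))"

definition pcd_feasible ::
  "(real \<Rightarrow> real) \<Rightarrow> real \<Rightarrow> real \<Rightarrow> nat \<Rightarrow> (nat \<Rightarrow> nat \<Rightarrow> 'a::euclidean_space) \<Rightarrow> nat \<Rightarrow> 'a set" where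
  "pcd_feasible S \<beta> \<tau> K g t =
     {d. \<forall>j\<in>{2..K}. normalized S \<beta> (g j) t \<bullet> d \<ge> \<tau> * (norm (normalized S \<beta> (g j) t))\<^sup>2}"

(* Only meaningful when the feasible set is nonempty; the minimizer is then unique, see below. *)
definition pcd_direction ::
  "(real \<Rightarrow> real) \<Rightarrow> real \<Rightarrow> real \<Rightarrow> nat \<Rightarrow> (nat \<Rightarrow> nat \<Rightarrow> 'a::euclidean_space) \<Rightarrow> nat \<Rightarrow> 'a" where
  "pcd_direction S \<beta> \<tau> K g t =
     (ARG_MIN (\<lambda>d. (norm (d - normalized S \<beta> (g 1) t))\<^sup>2) d. d \<in> pcd_feasible S \<beta> \<tau> K g t)"

lemma closed_convex_pcd_feasible:
  "closed (pcd_feasible S \<beta> \<tau> K g t)" "convex (pcd_feasible S \<beta> \<tau> K g t)"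
proof -
  have eq: "pcd_feasible S \<beta> \<tau> K g t =
    (\<Inter>j\<in>{2..K}. {d. normalized S \<beta> (g j) t \<bullet> d \<ge> \<tau> * (norm (normalized S \<beta> (g j) t))\<^sup>2})"
    unfolding pcd_feasible_def by auto
  show "closed (pcd_feasible S \<beta> \<tau> K g t)"
    unfolding eq by (intro closed_INT ballI closed_halfspace_ge)
  show "convex (pcd_feasible S \<beta> \<tau> K g t)"
    unfolding eq by (intro convex_INT convex_halfspace_ge)
qed

lemma pcd_minimizer_unique:
  assumes "pcd_feasible S \<beta> \<tau> K g t \<noteq> {}"
  shows "\<exists>!d. is_arg_min (\<lambda>d. (norm (d - p))\<^sup>2) (\<lambda>d. d \<in> pcd_feasible S \<beta> \<tau> K g t) d"
proof -
  let ?C = "pcd_feasible S \<beta> \<tau> K g t"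
  have iff: "is_arg_min (\<lambda>d. (norm (d - p))\<^sup>2) (\<lambda>d. d \<in> ?C) d \<longleftrightarrow>
      d \<in> ?C \<and> (\<forall>y\<in>?C. dist p d \<le> dist p y)" for d
    by (auto simp: is_arg_min_linorder dist_norm norm_minus_commute)
  show ?thesis
    unfolding iff
  proof (rule ex1I)
    show "closest_point ?C p \<in> ?C \<and> (\<forall>y\<in>?C. dist p (closest_point ?C p) \<le> dist p y)"
      using closest_point_exists[OF closed_convex_pcd_feasible(1) assms] by blast
    show "d = closest_point ?C p" if "d \<in> ?C \<and> (\<forall>y\<in>?C. dist p d \<le> dist p y)" for d
      using closest_point_unique[OF closed_convex_pcd_feasible(2,1)] that by blast
  qed
qed

end

(* Rescaling an objective by c multiplies its moving average by c^2, so the normalized gradients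
   before and after rescaling are positive multiples r of each other, with r = 1 for the alternative
   normalization and r close to 1 for the standard one when the averages dominate the stabilizer.
   Since the constraints read a . d >= tau * |a|^2, replacing a by r a with 1/m <= r <= m makes the
   two feasible sets absorb each other under dilation by m.  The dilate by m of one minimizer is therefore
   feasible and nearly optimal for the other problem, and strong convexity of the squared distance
   places it near the other minimizer, at a rate that does not depend on the geometry of the
   polyhedra and hence not on t. *)
theory Submission
  imports Defs
begin

section \<open>Stability of projections under mutual dilation of the sets\<close>

text \<open>The dilate of \<open>d\<close> competes with \<open>e\<close> for the distance to
  \<open>q\<close>, and the dilate \<open>x\<close> of \<open>e\<close> lies in \<open>S\<close>. So
  \<open>x\<close> is farther from \<open>p\<close> than \<open>d\<close> by at most a multiple of
  \<kappa>, and the variational inequality at \<open>d\<close> turns this excess into a bound on the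
  square of \<open>norm (x - d)\<close>; hence the rate \<open>sqrt \<kappa>\<close>.\<close>

lemma closest_point_stable_under_dilation:
  fixes S T :: "'a::euclidean_space set"
  assumes S: "convex S" "closed S" "S \<noteq> {}" and T: "closed T"
    and ST: "\<And>x. x \<in> S \<Longrightarrow> (1 + \<kappa>) *\<^sub>R x \<in> T"
    and TS: "\<And>x. x \<in> T \<Longrightarrow> (1 + \<kappa>) *\<^sub>R x \<in> S"
    and q: "norm (q - p) \<le> \<kappa> * norm p" and \<kappa>: "0 \<le> \<kappa>" "\<kappa> \<le> 1"
  shows "norm (closest_point T q - closest_point S p)
    \<le> 6 * sqrt \<kappa> * (norm (closest_point S p) + 2 * norm p)"
proof -
  define d where "d = closest_point S p"
  define e where "e = closest_point T q"
  define x where "x = (1 + \<kappa>) *\<^sub>R e"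
  \<comment> \<open>One length scale for all error terms: it dominates \<open>norm (d - p)\<close>,
    and twice it dominates \<open>norm e\<close>.\<close>
  define M where "M = norm d + 2 * norm p"
  have M0: "0 \<le> M" by (simp add: M_def)
  have dS: "d \<in> S"
    unfolding d_def using closest_point_in_set S by blast
  then have dT: "(1 + \<kappa>) *\<^sub>R d \<in> T" by (rule ST)
  then have eT: "e \<in> T"
    unfolding e_def using closest_point_in_set T by blast
  then have xS: "x \<in> S" unfolding x_def by (rule TS)
  have "norm (e - q) \<le> norm ((1 + \<kappa>) *\<^sub>R d - q)"
    using closest_point_le[OF T dT, of q] by (simp add: e_def dist_norm norm_minus_commute)
  also have "(1 + \<kappa>) *\<^sub>R d - q = (d - p) + (\<kappa> *\<^sub>R d + (p - q))"
    by (simp add: algebra_simps)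
  also have "norm \<dots> \<le> norm (d - p) + (norm (\<kappa> *\<^sub>R d) + norm (p - q))"
    by (rule order_trans[OF norm_triangle_ineq add_left_mono[OF norm_triangle_ineq]])
  finally have eq: "norm (e - q) \<le> norm (d - p) + \<kappa> * (norm d + norm p)"
    using q \<kappa> by (simp add: norm_minus_commute algebra_simps)
  have dp: "norm (d - p) \<le> norm d + norm p" by (rule norm_triangle_ineq4)
  then have dpM: "norm (d - p) \<le> M" using norm_ge_zero[of p] unfolding M_def by linarith
  have "norm q \<le> norm p + norm (q - p)" by (metis norm_triangle_sub)
  moreover have "norm e \<le> norm q + norm (e - q)" by (metis norm_triangle_sub)
  \<comment> \<open>The terms free of \<kappa> add up to \<open>norm d + 2 * norm p\<close>, and so
    do the coefficients of \<kappa>; hence the weight 2 in \<open>M\<close>.\<close>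
  ultimately have "norm e \<le> M + \<kappa> * M"
    using eq dp q by (simp add: M_def algebra_simps)
  moreover have \<kappa>M: "\<kappa> * M \<le> M" using mult_right_mono[OF \<kappa>(2) M0] by simp
  ultimately have e2: "norm e \<le> 2 * M" by simp
  have \<kappa>e: "\<kappa> * norm e \<le> 2 * (\<kappa> * M)"
    using mult_left_mono[OF e2 \<kappa>(1)] by simp
  have "x - p = (e - q) + (\<kappa> *\<^sub>R e + (q - p))"
    by (simp add: x_def algebra_simps)
  also have "norm \<dots> \<le> norm (e - q) + (norm (\<kappa> *\<^sub>R e) + norm (q - p))"
    by (rule order_trans[OF norm_triangle_ineq add_left_mono[OF norm_triangle_ineq]])
  \<comment> \<open>Of the 3, one comes from \<open>eq\<close> together with \<open>q\<close>, and
    two come from the shift \<open>\<kappa> *\<^sub>R e\<close>.\<close>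
  finally have xp: "norm (x - p) \<le> norm (d - p) + 3 * (\<kappa> * M)"
    using eq q \<kappa>e \<kappa> by (simp add: M_def algebra_simps)
  \<comment> \<open>The angle at the projection \<open>d\<close> is obtuse.\<close>
  have "(p - d) \<bullet> (x - d) \<le> 0"
    unfolding d_def by (rule closest_point_dot[OF S(1,2) xS])
  moreover have "(norm (x - p))\<^sup>2 = (norm (x - d))\<^sup>2 + (norm (d - p))\<^sup>2 - 2 * ((p - d) \<bullet> (x - d))"
    by (simp add: power2_norm_eq_inner inner_diff_left inner_diff_right inner_commute)
  ultimately have "(norm (x - d))\<^sup>2 \<le> (norm (x - p))\<^sup>2 - (norm (d - p))\<^sup>2" by simp
  also have "\<dots> \<le> (norm (d - p) + 3 * (\<kappa> * M))\<^sup>2 - (norm (d - p))\<^sup>2"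
    using xp by (simp add: power_mono)
  also have "\<dots> = 6 * (\<kappa> * M) * norm (d - p) + 9 * (\<kappa> * M) * (\<kappa> * M)"
    by (simp add: power2_eq_square algebra_simps)
  also have "\<dots> \<le> 6 * (\<kappa> * M) * M + 9 * (\<kappa> * M) * M"
    using dpM \<kappa>M \<kappa> M0 by (intro add_mono mult_left_mono) simp_all
  \<comment> \<open>The sum 6 + 9 = 15 is rounded up to a perfect square.\<close>
  also have "\<dots> \<le> 16 * (\<kappa> * M) * M"
    using \<kappa> M0 by simp
  also have "\<dots> = (4 * sqrt \<kappa> * M)\<^sup>2"
    using \<kappa> by (simp add: power_mult_distrib) (simp add: power2_eq_square)
  finally have xd: "norm (x - d) \<le> 4 * sqrt \<kappa> * M"
    using \<kappa> M0 by (auto intro: power2_le_imp_le)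
  \<comment> \<open>Returning from \<open>x\<close> to \<open>e\<close> costs 2 \<kappa> M. As
    \<kappa> \<le> 1, this is at most 2 sqrt(\<kappa>) M, so the constant is 6 = 4 + 2.\<close>
  have "\<kappa> * 1 \<le> sqrt \<kappa>"
    using \<kappa> by (intro real_le_rsqrt) (simp add: power2_eq_square mult_left_le)
  then have \<kappa>s: "\<kappa> * M \<le> sqrt \<kappa> * M" using M0 by (simp add: mult_right_mono)
  have "e - d = (x - d) - \<kappa> *\<^sub>R e"
    by (simp add: x_def algebra_simps)
  also have "norm \<dots> \<le> norm (x - d) + norm (\<kappa> *\<^sub>R e)" by (rule norm_triangle_ineq4)
  finally have "norm (e - d) \<le> 6 * sqrt \<kappa> * M"
    using xd \<kappa>e \<kappa>s \<kappa> by simp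
  then show ?thesis by (simp add: d_def e_def M_def)
qed

section \<open>PCD problems whose normalized gradients are nearly equal\<close>

text \<open>\<open>ARG_MIN\<close> chooses some minimizer; on a nonempty closed convex set the only
  one is the projection, to which the stability bound applies.\<close>

lemma pcd_direction_eq_closest_point:
  assumes "pcd_feasible S \<beta> \<tau> K g t \<noteq> {}"
  shows "pcd_direction S \<beta> \<tau> K g t
    = closest_point (pcd_feasible S \<beta> \<tau> K g t) (normalized S \<beta> (g 1) t)"
proof -
  let ?C = "pcd_feasible S \<beta> \<tau> K g t" and ?p = "normalized S \<beta> (g 1) t"
  have "is_arg_min (\<lambda>d. (norm (d - ?p))\<^sup>2) (\<lambda>d. d \<in> ?C) (pcd_direction S \<beta> \<tau> K g t)"
    unfolding pcd_direction_def arg_min_def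
    using someI_ex[OF ex1_implies_ex[OF pcd_minimizer_unique[OF assms]]] .
  then have "pcd_direction S \<beta> \<tau> K g t \<in> ?C"
    "\<forall>y\<in>?C. dist ?p (pcd_direction S \<beta> \<tau> K g t) \<le> dist ?p y"
    by (auto simp: is_arg_min_linorder dist_norm norm_minus_commute)
  then show ?thesis
    using closest_point_unique[OF closed_convex_pcd_feasible(2,1)] by blast
qed

text \<open>Passing from a to r a multiplies a . d by r but the threshold by r^2. Dilating d by m
  \<ge> r makes up for the extra factor, because a . d \<ge> \<tau> |a|^2 \<ge> 0.\<close>

lemma pcd_feasible_dilation:
  assumes \<tau>: "0 \<le> \<tau>" and d: "d \<in> pcd_feasible S \<beta> \<tau> K g t"
    and rel: "\<And>j. j \<in> {2..K} \<Longrightarrow> \<exists>r>0. r \<le> m \<and>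
      normalized S' \<beta> (g' j) t = r *\<^sub>R normalized S \<beta> (g j) t"
  shows "m *\<^sub>R d \<in> pcd_feasible S' \<beta> \<tau> K g' t"
  unfolding pcd_feasible_def
proof (rule CollectI, rule ballI)
  fix j assume j: "j \<in> {2..K}"
  let ?a = "normalized S \<beta> (g j) t"
  obtain r where r: "0 < r" "r \<le> m" and eq: "normalized S' \<beta> (g' j) t = r *\<^sub>R ?a"
    using rel[OF j] by blast
  have a: "\<tau> * (norm ?a)\<^sup>2 \<le> ?a \<bullet> d"
    using d j by (simp add: pcd_feasible_def)
  moreover have "0 \<le> \<tau> * (norm ?a)\<^sup>2" using \<tau> by simp
  ultimately have "r * (\<tau> * (norm ?a)\<^sup>2) \<le> m * (?a \<bullet> d)"
    using r by (intro mult_mono) auto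
  then have "r * (r * (\<tau> * (norm ?a)\<^sup>2)) \<le> r * (m * (?a \<bullet> d))"
    using r by (intro mult_left_mono) auto
  then show "\<tau> * (norm (normalized S' \<beta> (g' j) t))\<^sup>2 \<le> normalized S' \<beta> (g' j) t \<bullet> (m *\<^sub>R d)"
    unfolding eq by (simp add: power2_eq_square algebra_simps)
qed

text \<open>The interval for \<open>r\<close> is invariant under inversion, which makes the relation
  symmetric. Two scale functions are allowed so that different stabilizers can be compared as well
  as different gradients.\<close>

definition comparable_gradients ::
  "real \<Rightarrow> (real \<Rightarrow> real) \<Rightarrow> (real \<Rightarrow> real) \<Rightarrow> real \<Rightarrow> nat
     \<Rightarrow> (nat \<Rightarrow> nat \<Rightarrow> 'a::euclidean_space) \<Rightarrow> (nat \<Rightarrow> nat \<Rightarrow> 'a) \<Rightarrow> nat \<Rightarrow> bool" where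
  "comparable_gradients \<kappa> S S' \<beta> K g g' t \<longleftrightarrow>
     (\<forall>i\<in>{1..K}. \<exists>r. 1 / (1 + \<kappa>) \<le> r \<and> r \<le> 1 + \<kappa> \<and>
        normalized S' \<beta> (g' i) t = r *\<^sub>R normalized S \<beta> (g i) t)"

lemma comparable_gradients_sym:
  assumes "comparable_gradients \<kappa> S S' \<beta> K g g' t" and \<kappa>: "0 \<le> \<kappa>"
  shows "comparable_gradients \<kappa> S' S \<beta> K g' g t"
  unfolding comparable_gradients_def
proof
  fix i assume "i \<in> {1..K}"
  then obtain r where r: "1 / (1 + \<kappa>) \<le> r" "r \<le> 1 + \<kappa>"
    and eq: "normalized S' \<beta> (g' i) t = r *\<^sub>R normalized S \<beta> (g i) t"
    using assms(1) unfolding comparable_gradients_def by blast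
  have "0 < 1 / (1 + \<kappa>)" using \<kappa> by simp
  then have r0: "0 < r" using r by linarith
  show "\<exists>r. 1 / (1 + \<kappa>) \<le> r \<and> r \<le> 1 + \<kappa> \<and>
        normalized S \<beta> (g i) t = r *\<^sub>R normalized S' \<beta> (g' i) t"
    using r r0 \<kappa> eq by (intro exI[of _ "1 / r"]) (auto simp: field_simps)
qed

lemma comparable_gradients_feasible:
  assumes "comparable_gradients \<kappa> S S' \<beta> K g g' t" and \<kappa>: "0 \<le> \<kappa>" and "0 \<le> \<tau>"
    and "d \<in> pcd_feasible S \<beta> \<tau> K g t"
  shows "(1 + \<kappa>) *\<^sub>R d \<in> pcd_feasible S' \<beta> \<tau> K g' t"
proof (rule pcd_feasible_dilation[OF assms(3,4)])
  fix j assume "j \<in> {2..K}"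
  then have "j \<in> {1..K}" by simp
  then obtain r where "1 / (1 + \<kappa>) \<le> r" "r \<le> 1 + \<kappa>"
    "normalized S' \<beta> (g' j) t = r *\<^sub>R normalized S \<beta> (g j) t"
    using assms(1) unfolding comparable_gradients_def by blast
  moreover have "0 < 1 / (1 + \<kappa>)" using \<kappa> by simp
  ultimately show "\<exists>r>0. r \<le> 1 + \<kappa> \<and> normalized S' \<beta> (g' j) t = r *\<^sub>R normalized S \<beta> (g j) t"
    by (meson less_le_trans)
qed

lemma comparable_gradients_feasible_iff:
  assumes "comparable_gradients \<kappa> S S' \<beta> K g g' t" and "0 \<le> \<kappa>" "0 \<le> \<tau>"
  shows "pcd_feasible S' \<beta> \<tau> K g' t \<noteq> {} \<longleftrightarrow> pcd_feasible S \<beta> \<tau> K g t \<noteq> {}"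
  using comparable_gradients_feasible[OF assms]
    comparable_gradients_feasible[OF comparable_gradients_sym[OF assms(1,2)] assms(2,3)]
  by blast

lemma comparable_gradients_direction:
  assumes comp: "comparable_gradients \<kappa> S S' \<beta> K g g' t" and \<kappa>: "0 \<le> \<kappa>" "\<kappa> \<le> 1"
    and \<tau>: "0 \<le> \<tau>" and K: "1 \<le> K" and ne: "pcd_feasible S \<beta> \<tau> K g t \<noteq> {}"
  shows "norm (pcd_direction S' \<beta> \<tau> K g' t - pcd_direction S \<beta> \<tau> K g t)
    \<le> 6 * sqrt \<kappa> * (norm (pcd_direction S \<beta> \<tau> K g t) + 2 * norm (normalized S \<beta> (g 1) t))"
proof -
  let ?p = "normalized S \<beta> (g 1) t" and ?q = "normalized S' \<beta> (g' 1) t"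
  note dil = comparable_gradients_feasible[OF comp \<kappa>(1) \<tau>]
  note dil' = comparable_gradients_feasible[OF comparable_gradients_sym[OF comp \<kappa>(1)] \<kappa>(1) \<tau>]
  have ne': "pcd_feasible S' \<beta> \<tau> K g' t \<noteq> {}" using ne comparable_gradients_feasible_iff[OF comp \<kappa>(1) \<tau>] by blast
  obtain r where r: "1 / (1 + \<kappa>) \<le> r" "r \<le> 1 + \<kappa>" and eq: "?q = r *\<^sub>R ?p"
    using comp K unfolding comparable_gradients_def by (meson atLeastAtMost_iff order_refl)
  \<comment> \<open>Bounds \<open>r\<close> below by 1 - \<kappa>, so that the targets differ by at
    most \<open>\<kappa> * norm ?p\<close>, as the stability lemma asks.\<close>
  have "1 - \<kappa> \<le> 1 / (1 + \<kappa>)" using \<kappa> by (simp add: field_simps)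
  then have "\<bar>r - 1\<bar> \<le> \<kappa>" using r by simp
  moreover have "?q - ?p = (r - 1) *\<^sub>R ?p" unfolding eq by (simp add: algebra_simps)
  ultimately have "norm (?q - ?p) \<le> \<kappa> * norm ?p" by (simp add: mult_right_mono)
  then show ?thesis
    unfolding pcd_direction_eq_closest_point[OF ne] pcd_direction_eq_closest_point[OF ne']
    by (intro closest_point_stable_under_dilation closed_convex_pcd_feasible ne dil dil' \<kappa>)
qed

section \<open>Moving averages and normalized gradients under rescaling\<close>

lemma ema_scaleR: "ema \<beta> (\<lambda>t. c *\<^sub>R h t) t = c\<^sup>2 * ema \<beta> h t"
  by (induction t) (simp_all add: algebra_simps)

lemma ema_hat_scaleR: "ema_hat \<beta> (\<lambda>t. c *\<^sub>R h t) t = c\<^sup>2 * ema_hat \<beta> h t"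
  by (simp add: ema_hat_def ema_scaleR)

lemma ema_nonneg: "0 \<le> \<beta> \<Longrightarrow> \<beta> \<le> 1 \<Longrightarrow> 0 \<le> ema \<beta> h t"
  by (induction t) auto

text \<open>The newest summand of the recursion is the left-hand side, the older ones are
  nonnegative, and dividing by 1 - \<beta>^t in (0,1) only enlarges the sum.\<close>

lemma ema_hat_ge:
  assumes "0 < \<beta>" "\<beta> < 1" "1 \<le> t"
  shows "(1 - \<beta>) * (norm (h t))\<^sup>2 \<le> ema_hat \<beta> h t"
proof -
  obtain s where t: "t = Suc s" using assms(3) by (cases t) auto
  have "0 < \<beta> ^ t" "\<beta> ^ t < 1"
    using assms by (auto simp: power_less_one_iff)
  then have "ema \<beta> h t \<le> ema_hat \<beta> h t"
    using ema_nonneg[of \<beta> h t] assms by (simp add: ema_hat_def pos_le_divide_eq mult_left_le)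
  moreover have "(1 - \<beta>) * (norm (h t))\<^sup>2 \<le> ema \<beta> h t"
    using ema_nonneg[of \<beta> h s] assms by (simp add: t)
  ultimately show ?thesis by simp
qed

lemma ema_hat_nonneg:
  assumes "0 < \<beta>" "\<beta> < 1" "1 \<le> t"
  shows "0 \<le> ema_hat \<beta> h t"
proof -
  have "0 \<le> (1 - \<beta>) * (norm (h t))\<^sup>2" using assms by simp
  then show ?thesis using ema_hat_ge[OF assms, of h] by linarith
qed

lemma ema_hat_zeroD:
  assumes "0 < \<beta>" "\<beta> < 1" "1 \<le> t" "ema_hat \<beta> h t = 0"
  shows "h t = 0"
  using ema_hat_ge[OF assms(1-3), of h] assms by (simp add: mult_le_0_iff)

text \<open>Homogeneity of degree -1/2. At \<open>w = 0\<close> both sides vanish because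
  \<open>0 powr x = 0\<close>.\<close>

lemma scale_rescaled:
  assumes "0 < (c::real)" "0 \<le> w"
  shows "(c\<^sup>2 * w) powr (- (1 / 2)) * c = w powr (- (1 / 2))"
proof -
  have "(c\<^sup>2) powr (- (1 / 2)) = c powr (- 1)"
    using assms by (simp add: powr_powr flip: powr_numeral)
  then show ?thesis using assms by (simp add: powr_mult powr_minus field_simps)
qed

text \<open>Here the stabilizer multiplies the average, so c^2 factors out of the whole argument of
  the power and cancels exactly.\<close>

lemma normalized_alt_scaleR:
  assumes "0 < \<beta>" "\<beta> < 1" "1 \<le> t" "0 < c" "0 \<le> \<epsilon>"
  shows "normalized (scale_alt \<epsilon>) \<beta> (\<lambda>t. c *\<^sub>R h t) t = normalized (scale_alt \<epsilon>) \<beta> h t"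
  using scale_rescaled[of c "ema_hat \<beta> h t * (1 + \<epsilon>)"] ema_hat_nonneg[OF assms(1-3), of h] assms(4,5)
  by (simp add: normalized_def ema_hat_scaleR scale_alt_def mult.assoc)

text \<open>Since c^2 v + \<epsilon> = c^2 (v + \<epsilon> / c^2), rescaling an objective amounts to
  keeping its gradients and changing its stabilizer. All comparisons below are therefore between
  stabilizers on the same average.\<close>

lemma normalized_std_scaleR:
  assumes "0 < \<beta>" "\<beta> < 1" "1 \<le> t" "0 < c" "0 \<le> \<epsilon>"
  shows "normalized (scale_std \<epsilon>) \<beta> (\<lambda>t. c *\<^sub>R h t) t = normalized (scale_std (\<epsilon> / c\<^sup>2)) \<beta> h t"
proof -
  have "c\<^sup>2 * ema_hat \<beta> h t + \<epsilon> = c\<^sup>2 * (ema_hat \<beta> h t + \<epsilon> / c\<^sup>2)"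
    using assms by (simp add: field_simps)
  then show ?thesis
    using scale_rescaled[of c "ema_hat \<beta> h t + \<epsilon> / c\<^sup>2"] ema_hat_nonneg[OF assms(1-3), of h] assms(4,5)
    by (simp add: normalized_def ema_hat_scaleR scale_std_def)
qed

text \<open>The average is at least (1 - \<beta>) |h t|^2. The bound is free of \<open>t\<close>,
  \<epsilon> and \<open>h\<close>, which is what makes the later estimate uniform.\<close>

lemma norm_normalized_std_le:
  assumes "0 < \<beta>" "\<beta> < 1" "1 \<le> t" "0 \<le> \<epsilon>"
  shows "norm (normalized (scale_std \<epsilon>) \<beta> h t) \<le> 1 / sqrt (1 - \<beta>)"
proof (cases "ema_hat \<beta> h t = 0")
  case True
  then show ?thesis using ema_hat_zeroD[OF assms(1-3), of h] assms by (simp add: normalized_def)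
next
  case False
  let ?v = "ema_hat \<beta> h t"
  have v: "0 < ?v" using False ema_hat_nonneg[OF assms(1-3), of h] by simp
  have "norm (h t) * sqrt (1 - \<beta>) = sqrt ((1 - \<beta>) * (norm (h t))\<^sup>2)"
    by (simp add: real_sqrt_mult)
  also have "\<dots> \<le> sqrt (?v + \<epsilon>)"
    using ema_hat_ge[OF assms(1-3), of h] assms(4) by simp
  finally have "norm (h t) * sqrt (1 - \<beta>) \<le> sqrt (?v + \<epsilon>)" .
  moreover have "norm (normalized (scale_std \<epsilon>) \<beta> h t) = norm (h t) / sqrt (?v + \<epsilon>)"
    using v assms by (simp add: normalized_def scale_std_def powr_minus powr_half_sqrt field_simps)
  moreover have "0 < sqrt (?v + \<epsilon>)" "0 < sqrt (1 - \<beta>)" using v assms by auto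
  ultimately show ?thesis by (simp add: pos_le_divide_eq pos_divide_le_eq)
qed

section \<open>The standard normalization with dominated stabilizers\<close>

lemma scale_std_ratio:
  assumes "0 < v" "0 \<le> e" "0 \<le> e'" "e \<le> \<kappa> * v" "e' \<le> \<kappa> * v"
  shows "\<exists>r. 1 / (1 + \<kappa>) \<le> r \<and> r \<le> 1 + \<kappa> \<and> scale_std e' v = r * scale_std e v"
proof -
  \<comment> \<open>Stated for an arbitrary pair, so that it can be used in both orders: one gives
    the lower, the other the upper bound on the ratio.\<close>
  have half: "scale_std e v \<le> (1 + \<kappa>) * scale_std e' v"
    if "0 \<le> e" "0 \<le> e'" "e' \<le> \<kappa> * v" for e e'
  proof -
    have "0 \<le> \<kappa>" using assms(1) that by (metis order_trans zero_le_mult_iff not_less)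
    have "v + e' \<le> (1 + \<kappa>) * (v + e)"
      using that \<open>0 \<le> \<kappa>\<close> by (simp add: algebra_simps add_increasing)
    \<comment> \<open>Weakened to a square so that the root yields the factor 1 + \<kappa>.\<close>
    also have "\<dots> \<le> (1 + \<kappa>)\<^sup>2 * (v + e)"
      using \<open>0 \<le> \<kappa>\<close> that assms(1) by (intro mult_right_mono) (auto simp: power2_eq_square algebra_simps)
    finally have "sqrt (v + e') \<le> (1 + \<kappa>) * sqrt (v + e)"
      using \<open>0 \<le> \<kappa>\<close> real_sqrt_le_mono by (fastforce simp: real_sqrt_mult)
    then show ?thesis
      using that assms(1) by (simp add: scale_std_def powr_minus powr_half_sqrt field_simps)
  qed
  have pos: "0 < scale_std e v" using assms by (simp add: scale_std_def)
  have "0 \<le> \<kappa>" using assms(1-4) by (metis order_trans zero_le_mult_iff not_less)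
  then show ?thesis
    using half[OF assms(2,3,5)] half[OF assms(3,2,4)] pos
    by (intro exI[of _ "scale_std e' v / scale_std e v"]) (simp add: field_simps)
qed

text \<open>The stabilizers \<open>e\<close> and \<epsilon> are kept separate: \<open>e = 0\<close>
  serves the limit, \<open>e = \<epsilon>\<close> the comparison at a fixed stabilizer. Domination
  is asked for only at positive averages; at a zero average the gradient vanishes and
  \<open>r = 1\<close> works.\<close>

lemma comparable_gradients_std:
  assumes \<beta>: "0 < \<beta>" "\<beta> < 1" and t: "1 \<le> t" and e: "0 \<le> e" "0 \<le> \<epsilon>" and \<kappa>: "0 \<le> \<kappa>"
    and c: "\<And>i. i \<in> {1..K} \<Longrightarrow> 0 < c i"
    and dom: "\<And>i. i \<in> {1..K} \<Longrightarrow> 0 < ema_hat \<beta> (g i) t \<Longrightarrow>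
      e \<le> \<kappa> * ema_hat \<beta> (g i) t \<and> \<epsilon> / (c i)\<^sup>2 \<le> \<kappa> * ema_hat \<beta> (g i) t"
  shows "comparable_gradients \<kappa> (scale_std e) (scale_std \<epsilon>) \<beta> K g (\<lambda>i t. c i *\<^sub>R g i t) t"
  unfolding comparable_gradients_def
proof
  fix i assume i: "i \<in> {1..K}"
  let ?v = "ema_hat \<beta> (g i) t"
  note eq = normalized_std_scaleR[OF \<beta> t c[OF i] e(2), of "g i"]
  show "\<exists>r. 1 / (1 + \<kappa>) \<le> r \<and> r \<le> 1 + \<kappa> \<and>
    normalized (scale_std \<epsilon>) \<beta> (\<lambda>t. c i *\<^sub>R g i t) t = r *\<^sub>R normalized (scale_std e) \<beta> (g i) t"
  proof (cases "?v = 0")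
    case True
    then have "g i t = 0" by (rule ema_hat_zeroD[OF \<beta> t])
    then show ?thesis using \<kappa> by (intro exI[of _ 1]) (simp add: normalized_def)
  next
    case False
    then have v: "0 < ?v" using ema_hat_nonneg[OF \<beta> t, of "g i"] by simp
    obtain r where "1 / (1 + \<kappa>) \<le> r" "r \<le> 1 + \<kappa>"
      "scale_std (\<epsilon> / (c i)\<^sup>2) ?v = r * scale_std e ?v"
      using scale_std_ratio[of ?v e "\<epsilon> / (c i)\<^sup>2" \<kappa>] v e dom[OF i v] by auto
    then show ?thesis unfolding eq by (auto simp: normalized_def)
  qed
qed

lemma eventually_comparable_gradients_std:
  assumes \<beta>: "0 < \<beta>" "\<beta> < 1" and t: "1 \<le> t" and \<kappa>: "0 < \<kappa>"
    and c: "\<And>i. i \<in> {1..K} \<Longrightarrow> 0 < c i"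
  shows "\<forall>\<^sub>F \<epsilon> in at_right 0.
    comparable_gradients \<kappa> (scale_std 0) (scale_std \<epsilon>) \<beta> K g (\<lambda>i t. c i *\<^sub>R g i t) t"
proof -
  have "\<forall>\<^sub>F \<epsilon> in at_right 0. \<forall>i\<in>{1..K}.
    0 < ema_hat \<beta> (g i) t \<longrightarrow> \<epsilon> / (c i)\<^sup>2 \<le> \<kappa> * ema_hat \<beta> (g i) t"
  proof (intro eventually_ball_finite ballI)
    fix i assume i: "i \<in> {1..K}"
    show "\<forall>\<^sub>F \<epsilon> in at_right 0. 0 < ema_hat \<beta> (g i) t \<longrightarrow> \<epsilon> / (c i)\<^sup>2 \<le> \<kappa> * ema_hat \<beta> (g i) t"
    proof (cases "0 < ema_hat \<beta> (g i) t")
      case True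
      \<comment> \<open>This positive number is the threshold below which \<epsilon> is small enough
        for objective \<open>i\<close>; only finitely many such conditions are combined.\<close>
      then have "0 < \<kappa> * ema_hat \<beta> (g i) t * (c i)\<^sup>2" using \<kappa> c[OF i] by simp
      then show ?thesis
        using c[OF i] by (auto intro: eventually_mono[OF eventually_at_right_real] simp: field_simps)
    qed simp
  qed simp
  moreover have "\<forall>\<^sub>F \<epsilon>::real in at_right 0. 0 < \<epsilon>" by (rule eventually_at_right_less)
  ultimately show ?thesis
    by eventually_elim (use \<beta> t \<kappa> c in \<open>auto intro!: comparable_gradients_std\<close>)
qed

section \<open>The limit of vanishing stabilizer\<close>

text \<open>Every rescaled problem is compared with the one unrescaled problem at stabilizer 0, so
  the limit does not depend on \<open>c\<close>.\<close>

lemma pcd_direction_std_tendsto: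
  assumes \<beta>: "0 < \<beta>" "\<beta> < 1" and t: "1 \<le> t" and \<tau>: "0 \<le> \<tau>" and K: "1 \<le> K"
    and c: "\<And>i. i \<in> {1..K} \<Longrightarrow> 0 < c i"
    and ne: "pcd_feasible (scale_std 0) \<beta> \<tau> K g t \<noteq> {}"
  shows "((\<lambda>\<epsilon>. pcd_direction (scale_std \<epsilon>) \<beta> \<tau> K (\<lambda>i t. c i *\<^sub>R g i t) t)
    \<longlongrightarrow> pcd_direction (scale_std 0) \<beta> \<tau> K g t) (at_right 0)"
proof (rule tendstoI)
  fix \<eta> :: real assume "0 < \<eta>"
  define M where
    "M = norm (pcd_direction (scale_std 0) \<beta> \<tau> K g t) + 2 * norm (normalized (scale_std 0) \<beta> (g 1) t)"
  have M: "0 \<le> M" by (simp add: M_def)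
  \<comment> \<open>Chosen so that 6 sqrt(\<kappa>) (M + 1) \<le> \<eta>; the summand 1 covers
    \<open>M = 0\<close> and makes the final inequality strict. The minimum with 1 keeps \<kappa> in
    the range of the stability bound.\<close>
  define \<kappa> where "\<kappa> = min 1 ((\<eta> / (6 * (M + 1)))\<^sup>2)"
  have \<kappa>: "0 < \<kappa>" "\<kappa> \<le> 1" using \<open>0 < \<eta>\<close> M by (auto simp: \<kappa>_def)
  have "sqrt \<kappa> \<le> \<eta> / (6 * (M + 1))"
    using \<open>0 < \<eta>\<close> M by (intro real_le_lsqrt) (auto simp: \<kappa>_def)
  then have "6 * sqrt \<kappa> * M < \<eta>"
    using M \<kappa> by (simp add: pos_le_divide_eq algebra_simps) (smt (verit) real_sqrt_gt_zero)
  moreover have "\<forall>\<^sub>F \<epsilon> in at_right 0.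
    comparable_gradients \<kappa> (scale_std 0) (scale_std \<epsilon>) \<beta> K g (\<lambda>i t. c i *\<^sub>R g i t) t"
    by (rule eventually_comparable_gradients_std[OF \<beta> t \<kappa>(1) c])
  ultimately show "\<forall>\<^sub>F \<epsilon> in at_right 0. dist (pcd_direction (scale_std \<epsilon>) \<beta> \<tau> K (\<lambda>i t. c i *\<^sub>R g i t) t)
      (pcd_direction (scale_std 0) \<beta> \<tau> K g t) < \<eta>"
    using comparable_gradients_direction[OF _ less_imp_le[OF \<kappa>(1)] \<kappa>(2) \<tau> K ne]
    by (auto elim!: eventually_mono simp: dist_norm M_def intro: le_less_trans)
qed

section \<open>Gradients and subgradients of the rescaled objectives\<close>

lemma is_subgradient_scaleR:
  assumes "is_subgradient f x p" "0 < c"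
  shows "is_subgradient (\<lambda>x. ereal c * f x) x (c *\<^sub>R p)"
  unfolding is_subgradient_def
proof (intro conjI allI)
  \<comment> \<open>With \<open>f x\<close> finite, the factor \<open>c\<close> distributes over the
    sum by real arithmetic.\<close>
  obtain a where a: "f x = ereal a"
    using assms(1) by (cases "f x") (auto simp: is_subgradient_def)
  then show "\<bar>ereal c * f x\<bar> \<noteq> \<infinity>" by simp
  fix y
  have "ereal c * (f x + ereal (p \<bullet> (y - x))) \<le> ereal c * f y"
    using assms by (intro ereal_mult_left_mono) (auto simp: is_subgradient_def)
  then show "ereal c * f x + ereal (c *\<^sub>R p \<bullet> (y - x)) \<le> ereal c * f y"
    by (simp add: a algebra_simps)
qed

lemma gradient_history_scaleR:
  assumes "gradient_history K L1 L \<theta> g" "1 \<le> K" "\<And>i. i \<in> {1..K} \<Longrightarrow> 0 < c i"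
  shows "gradient_history K (\<lambda>x. c 1 * L1 x) (\<lambda>i x. ereal (c i) * L i x) \<theta> (\<lambda>i t. c i *\<^sub>R g i t)"
  unfolding gradient_history_def
proof (intro allI impI conjI ballI)
  fix t :: nat assume t: "1 \<le> t"
  have "GDERIV L1 (\<theta> t) :> g 1 t" using assms(1) t by (simp add: gradient_history_def)
  then show "GDERIV (\<lambda>x. c 1 * L1 x) (\<theta> t) :> c 1 *\<^sub>R g 1 t"
    unfolding gderiv_def using has_derivative_mult_right[of L1 _ _ "c 1"] by simp
  fix i assume i: "i \<in> {2..K}"
  have "is_subgradient (L i) (\<theta> t) (g i t)" using assms(1) t i by (simp add: gradient_history_def)
  then show "is_subgradient (\<lambda>x. ereal (c i) * L i x) (\<theta> t) (c i *\<^sub>R g i t)"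
    using i by (intro is_subgradient_scaleR assms(3)) auto
qed

section \<open>Uniform closeness when the averages dominate the stabilizer\<close>

lemma pcd_direction_std_uniformly_close:
  assumes \<beta>: "0 < \<beta>" "\<beta> < 1" and \<tau>: "0 \<le> \<tau>" and K: "1 \<le> K"
    and c: "\<And>i. i \<in> {1..K} \<Longrightarrow> 0 < c i" and \<eta>: "0 < \<eta>"
  shows "\<exists>\<delta>>0. \<forall>t\<ge>1. \<forall>\<epsilon>>0.
    (\<forall>i\<in>{1..K}. \<epsilon> / (c i)\<^sup>2 \<le> \<delta> * ema_hat \<beta> (g i) t) \<longrightarrow>
    pcd_feasible (scale_std \<epsilon>) \<beta> \<tau> K g t \<noteq> {} \<longrightarrow>
    pcd_feasible (scale_std \<epsilon>) \<beta> \<tau> K (\<lambda>i t. c i *\<^sub>R g i t) t \<noteq> {} \<and>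
    norm (pcd_direction (scale_std \<epsilon>) \<beta> \<tau> K (\<lambda>i t. c i *\<^sub>R g i t) t
        - pcd_direction (scale_std \<epsilon>) \<beta> \<tau> K g t)
      \<le> \<eta> * (1 + norm (pcd_direction (scale_std \<epsilon>) \<beta> \<tau> K g t))"
proof -
  \<comment> \<open>Absorbs the uniform bound on the primary normalized gradient: norm d + 2 /
    sqrt(1 - \<beta>) \<le> B (1 + norm d).\<close>
  define B where "B = 1 + 2 / sqrt (1 - \<beta>)"
  have B: "1 \<le> B" using \<beta> by (simp add: B_def)
  define \<kappa> where "\<kappa> = min 1 ((\<eta> / (6 * B))\<^sup>2)"
  have \<kappa>: "0 < \<kappa>" "\<kappa> \<le> 1" using \<eta> B by (auto simp: \<kappa>_def)
  have "sqrt \<kappa> \<le> \<eta> / (6 * B)"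
    using \<eta> B by (intro real_le_lsqrt) (auto simp: \<kappa>_def)
  then have \<kappa>\<eta>: "6 * sqrt \<kappa> * B \<le> \<eta>"
    using B by (simp add: pos_le_divide_eq algebra_simps)
  \<comment> \<open>Comparability also needs \<epsilon> itself to be dominated, and passing from
    \<epsilon> / c_i^2 to \<epsilon> costs c_i^2 \<le> C. The summand 1 makes
    \<open>\<kappa> / C\<close> suffice for both bounds.\<close>
  define C where "C = 1 + (\<Sum>i\<in>{1..K}. (c i)\<^sup>2)"
  have C1: "1 \<le> C" by (simp add: C_def sum_nonneg)
  have Cc: "(c i)\<^sup>2 \<le> C" if "i \<in> {1..K}" for i
    using member_le_sum[OF that, of "\<lambda>i. (c i)\<^sup>2"] by (simp add: C_def)
  show ?thesis
  proof (rule exI[of _ "\<kappa> / C"], intro conjI allI impI)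
    show "0 < \<kappa> / C" using \<kappa> C1 by simp
    fix t :: nat and \<epsilon> :: real
    assume t: "1 \<le> t" and \<epsilon>: "0 < \<epsilon>"
      and dom: "\<forall>i\<in>{1..K}. \<epsilon> / (c i)\<^sup>2 \<le> \<kappa> / C * ema_hat \<beta> (g i) t"
      and ne: "pcd_feasible (scale_std \<epsilon>) \<beta> \<tau> K g t \<noteq> {}"
    let ?g' = "\<lambda>i t. c i *\<^sub>R g i t"
    let ?d = "pcd_direction (scale_std \<epsilon>) \<beta> \<tau> K g t"
    have "comparable_gradients \<kappa> (scale_std \<epsilon>) (scale_std \<epsilon>) \<beta> K g ?g' t"
    proof (rule comparable_gradients_std[OF \<beta> t _ _ _ c])
      fix i assume i: "i \<in> {1..K}" and v: "0 < ema_hat \<beta> (g i) t"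
      let ?v = "ema_hat \<beta> (g i) t"
      have "\<epsilon> / (c i)\<^sup>2 \<le> \<kappa> / C * ?v" using dom i by blast
      then have "\<epsilon> \<le> \<kappa> * ?v * ((c i)\<^sup>2 / C)" "\<epsilon> / (c i)\<^sup>2 \<le> \<kappa> * ?v * (1 / C)"
        using c[OF i] by (auto simp: pos_divide_le_eq algebra_simps)
      moreover have "\<kappa> * ?v * ((c i)\<^sup>2 / C) \<le> \<kappa> * ?v" "\<kappa> * ?v * (1 / C) \<le> \<kappa> * ?v"
        using Cc[OF i] C1 \<kappa> v by (intro mult_left_le; simp)+
      ultimately show "\<epsilon> \<le> \<kappa> * ?v \<and> \<epsilon> / (c i)\<^sup>2 \<le> \<kappa> * ?v" by linarith
    qed (use \<epsilon> \<kappa> in auto)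
    note comp = this
    have "norm ?d + 2 * norm (normalized (scale_std \<epsilon>) \<beta> (g 1) t) \<le> norm ?d + 2 / sqrt (1 - \<beta>)"
      using norm_normalized_std_le[OF \<beta> t less_imp_le[OF \<epsilon>], of "g 1"] by simp
    also have "\<dots> \<le> B * (1 + norm ?d)"
      using \<beta> by (simp add: B_def algebra_simps)
    finally have "6 * sqrt \<kappa> * (norm ?d + 2 * norm (normalized (scale_std \<epsilon>) \<beta> (g 1) t))
      \<le> 6 * sqrt \<kappa> * (B * (1 + norm ?d))"
      using \<kappa> by (intro mult_left_mono) auto
    also have "\<dots> \<le> \<eta> * (1 + norm ?d)"
      using mult_right_mono[OF \<kappa>\<eta>, of "1 + norm ?d"] by (simp add: mult.assoc)
    finally have bound: "6 * sqrt \<kappa> * (norm ?d + 2 * norm (normalized (scale_std \<epsilon>) \<beta> (g 1) t))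
      \<le> \<eta> * (1 + norm ?d)" .
    show "pcd_feasible (scale_std \<epsilon>) \<beta> \<tau> K ?g' t \<noteq> {}"
      using comparable_gradients_feasible_iff[OF comp less_imp_le[OF \<kappa>(1)] \<tau>] ne by blast
    show "norm (pcd_direction (scale_std \<epsilon>) \<beta> \<tau> K ?g' t - ?d) \<le> \<eta> * (1 + norm ?d)"
      using comparable_gradients_direction[OF comp less_imp_le[OF \<kappa>(1)] \<kappa>(2) \<tau> K ne] bound
      by (rule order_trans)
  qed
qed

section \<open>Scale invariance of the PCD direction\<close>

text \<open>For the standard normalization objective \<open>i\<close> sees the stabilizer \<epsilon>
  / c_i^2, so agreement is asymptotic: "as \<epsilon> tends to 0" becomes a common limit, and "much
  larger than" becomes a threshold \<delta>, uniform in \<open>t\<close> and \<epsilon>, for a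
  relative error \<eta>.\<close>

theorem theoremB8:
  fixes K :: nat
    and L1 L1' :: "real ^ 'n \<Rightarrow> real"
    and L L' :: "nat \<Rightarrow> real ^ 'n \<Rightarrow> ereal"
    and \<theta> :: "nat \<Rightarrow> real ^ 'n"
    and g g' :: "nat \<Rightarrow> nat \<Rightarrow> real ^ 'n"
    and c :: "nat \<Rightarrow> real"
    and \<beta> \<tau> :: real
  assumes "K \<ge> 2"
    and "0 < \<beta>" and "\<beta> < 1"
    and "0 \<le> \<tau>" and "\<tau> \<le> 1"
    and "pcd_objectives K L1 L"
    and "gradient_history K L1 L \<theta> g"
    and "\<forall>i\<in>{1..K}. c i > 0"
    and "L1' = (\<lambda>x. c 1 * L1 x)"
    and "L' = (\<lambda>i x. ereal (c i) * L i x)"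
    and "g' = (\<lambda>i t. c i *\<^sub>R g i t)"
  shows "gradient_history K L1' L' \<theta> g'
    \<and> (\<forall>t\<ge>1. (\<forall>\<^sub>F \<epsilon> in at_right 0. pcd_feasible (scale_std \<epsilon>) \<beta> \<tau> K g t \<noteq> {}) \<longrightarrow>
          (\<forall>\<^sub>F \<epsilon> in at_right 0. pcd_feasible (scale_std \<epsilon>) \<beta> \<tau> K g' t \<noteq> {}) \<and>
          (\<exists>d. ((\<lambda>\<epsilon>. pcd_direction (scale_std \<epsilon>) \<beta> \<tau> K g t) \<longlongrightarrow> d) (at_right 0) \<and>
               ((\<lambda>\<epsilon>. pcd_direction (scale_std \<epsilon>) \<beta> \<tau> K g' t) \<longlongrightarrow> d) (at_right 0)))
    \<and> (\<forall>\<eta>>0. \<exists>\<delta>>0. \<forall>t\<ge>1. \<forall>\<epsilon>>0.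
          (\<forall>i\<in>{1..K}. \<epsilon> / (c i)\<^sup>2 \<le> \<delta> * ema_hat \<beta> (g i) t) \<longrightarrow>
          pcd_feasible (scale_std \<epsilon>) \<beta> \<tau> K g t \<noteq> {} \<longrightarrow>
          pcd_feasible (scale_std \<epsilon>) \<beta> \<tau> K g' t \<noteq> {} \<and>
          norm (pcd_direction (scale_std \<epsilon>) \<beta> \<tau> K g' t - pcd_direction (scale_std \<epsilon>) \<beta> \<tau> K g t)
            \<le> \<eta> * (1 + norm (pcd_direction (scale_std \<epsilon>) \<beta> \<tau> K g t)))
    \<and> (\<forall>t\<ge>1. \<forall>\<epsilon>\<ge>0. pcd_feasible (scale_alt \<epsilon>) \<beta> \<tau> K g t \<noteq> {} \<longrightarrow>
          pcd_feasible (scale_alt \<epsilon>) \<beta> \<tau> K g' t \<noteq> {} \<and>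
          pcd_direction (scale_alt \<epsilon>) \<beta> \<tau> K g' t = pcd_direction (scale_alt \<epsilon>) \<beta> \<tau> K g t)"
proof (intro conjI allI impI)
  have K: "1 \<le> K" and c: "\<And>i. i \<in> {1..K} \<Longrightarrow> 0 < c i" using assms(1,8) by auto
  note \<beta> = assms(2,3) and \<tau> = assms(4) and g' = assms(11)
  show "gradient_history K L1' L' \<theta> g'"
    unfolding assms(9,10) g' by (rule gradient_history_scaleR[OF assms(7) K c])
  {
    fix t :: nat assume t: "1 \<le> t"
      and ev: "\<forall>\<^sub>F \<epsilon> in at_right 0. pcd_feasible (scale_std \<epsilon>) \<beta> \<tau> K g t \<noteq> {}"
    \<comment> \<open>Any positive \<kappa> would transfer feasibility, here 1; with trivial factors
      \<open>c\<close> this links the original problem at small \<epsilon> to the one at 0.\<close>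
    have "\<forall>\<^sub>F \<epsilon> in at_right 0. comparable_gradients 1 (scale_std 0) (scale_std \<epsilon>) \<beta> K g g t"
      using eventually_comparable_gradients_std[OF \<beta> t zero_less_one,
          where c = "\<lambda>_. 1" and K = K and g = g] by simp
    with ev have "\<forall>\<^sub>F \<epsilon>::real in at_right 0. pcd_feasible (scale_std 0) \<beta> \<tau> K g t \<noteq> {}"
      by eventually_elim (rule iffD1[OF comparable_gradients_feasible_iff[OF _ zero_le_one \<tau>]])
    \<comment> \<open>The property is free of \<epsilon>, and \<open>at_right 0\<close> is a
      nontrivial filter.\<close>
    then have ne: "pcd_feasible (scale_std 0) \<beta> \<tau> K g t \<noteq> {}" by simp
    have "\<forall>\<^sub>F \<epsilon> in at_right 0. comparable_gradients 1 (scale_std 0) (scale_std \<epsilon>) \<beta> K g g' t"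
      unfolding g' by (rule eventually_comparable_gradients_std[OF \<beta> t zero_less_one c])
    then show "\<forall>\<^sub>F \<epsilon> in at_right 0. pcd_feasible (scale_std \<epsilon>) \<beta> \<tau> K g' t \<noteq> {}"
      by (rule eventually_mono) (rule iffD2[OF comparable_gradients_feasible_iff[OF _ zero_le_one \<tau>] ne])
    show "\<exists>d. ((\<lambda>\<epsilon>. pcd_direction (scale_std \<epsilon>) \<beta> \<tau> K g t) \<longlongrightarrow> d) (at_right 0) \<and>
      ((\<lambda>\<epsilon>. pcd_direction (scale_std \<epsilon>) \<beta> \<tau> K g' t) \<longlongrightarrow> d) (at_right 0)"
      \<comment> \<open>The common limit is the direction of the original problem at stabilizer 0,
        reached once with trivial factors and once with \<open>c\<close>.\<close>
      using pcd_direction_std_tendsto[OF \<beta> t \<tau> K _ ne, where c = "\<lambda>_. 1"]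
        pcd_direction_std_tendsto[OF \<beta> t \<tau> K c ne]
      unfolding g' by (intro exI conjI) simp_all
  next
    fix \<eta> :: real assume \<eta>: "0 < \<eta>"
    show "\<exists>\<delta>>0. \<forall>t\<ge>1. \<forall>\<epsilon>>0.
          (\<forall>i\<in>{1..K}. \<epsilon> / (c i)\<^sup>2 \<le> \<delta> * ema_hat \<beta> (g i) t) \<longrightarrow>
          pcd_feasible (scale_std \<epsilon>) \<beta> \<tau> K g t \<noteq> {} \<longrightarrow>
          pcd_feasible (scale_std \<epsilon>) \<beta> \<tau> K g' t \<noteq> {} \<and>
          norm (pcd_direction (scale_std \<epsilon>) \<beta> \<tau> K g' t - pcd_direction (scale_std \<epsilon>) \<beta> \<tau> K g t)
            \<le> \<eta> * (1 + norm (pcd_direction (scale_std \<epsilon>) \<beta> \<tau> K g t))"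
      unfolding g' by (rule pcd_direction_std_uniformly_close[OF \<beta> \<tau> K c \<eta>])
  next
    fix t :: nat and \<epsilon> :: real assume t: "1 \<le> t" and \<epsilon>: "0 \<le> \<epsilon>"
      and ne: "pcd_feasible (scale_alt \<epsilon>) \<beta> \<tau> K g t \<noteq> {}"
    have "normalized (scale_alt \<epsilon>) \<beta> (g' i) t = normalized (scale_alt \<epsilon>) \<beta> (g i) t"
      if "i \<in> {1..K}" for i
      unfolding g' by (rule normalized_alt_scaleR[OF \<beta> t c[OF that] \<epsilon>])
    then have feas: "pcd_feasible (scale_alt \<epsilon>) \<beta> \<tau> K g' t = pcd_feasible (scale_alt \<epsilon>) \<beta> \<tau> K g t"
      and "normalized (scale_alt \<epsilon>) \<beta> (g' 1) t = normalized (scale_alt \<epsilon>) \<beta> (g 1) t"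
      using K by (auto simp: pcd_feasible_def)
    then show "pcd_direction (scale_alt \<epsilon>) \<beta> \<tau> K g' t = pcd_direction (scale_alt \<epsilon>) \<beta> \<tau> K g t"
      by (simp add: pcd_direction_def)
    show "pcd_feasible (scale_alt \<epsilon>) \<beta> \<tau> K g' t \<noteq> {}" using feas ne by simp
  }
qed

end
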